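(* Let $K\in L^1(\Omega)\cap L^2(\Omega)$ (real- or complex-valued), let $f\in\mathcal{C}(\Omega)$, and put $F=Kf$. Let $0<n'\le n$ be integers, and let the $m$-point quadrature rule with points $x_j\in\Omega$ and weights $w_j>0$, $j=1,\dots,m$, have exactness degree $n+n'$ and satisfy the Marcinkiewicz--Zygmund property with constant $\eta\in[0,1)$. Let $\mathcal{S}_nF$ be the efficient hyperinterpolant of degree $n$ of $F=Kf$. Then $$\|\mathcal{S}_nF\|_2\leq\|K\|_2\,\|\mathcal{L}_n\|_{\infty}\,\|f\|_{\infty},$$ where $\|\mathcal{L}_n\|_{\infty}$ denotes the norm of the hyperinterpolation operator $\mathcal{L}_n$ as an operator from $\mathcal{C}(\Omega)$ to $\mathcal{C}(\Omega)$, and $$\|\mathcal{S}_nF-F\|_2\leq(1+\|\mathcal{L}_n\|_{\infty})\,\|K\|_2\,E_{n'}(f)+2E_n^{(2)}(K\chi^* ),$$ where $E_{n'}(f)=\inf_{\chi\in\mathbb{P}_{n'}}\|f-\chi\|_\infty$, $E_n^{(2)}(g)=\inf_{\chi\in\mathbb{P}_n}\|g-\chi\|_2$, and $\chi^*\in\mathbb{P}_{n'}$ is the best uniform approximation of $f$ in $\mathbb{P}_{n'}$, i.e. $\|f-\chi^*\|_\infty=E_{n'}(f)$.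
   Context: $\Omega\subset\mathbb{R}^s$ is a bounded region, either the closure of a connected open domain or a smooth closed lower-dimensional manifold, with a given measure $\mathrm{d}\omega$ of finite total mass $V=\int_\Omega \mathrm{d}\omega<\infty$. $L^p(\Omega)$ ($1\le p<\infty$) is taken with respect to $\mathrm{d}\omega$ with norm $\|g\|_p=(\int_\Omega|g|^p\,\mathrm{d}\omega)^{1/p}$, and $\|g\|_\infty=\sup_{x\in\Omega}|g(x)|$. $\mathcal{C}(\Omega)$ is the space of continuous functions with norm $\|\cdot\|_\infty$. $\langle v,z\rangle=\int_\Omega v\bar z\,\mathrm{d}\omega$. Scalars are real if all given functions are real-valued, and complex otherwise. $\mathbb{P}_n$ is the linear space (over these scalars) of restrictions to $\Omega$ of polynomials of degree at most $n$, $d_n=\dim\mathbb{P}_n$, and $p_1,\dots,p_{d_n}$ is an orthonormal basis of $\mathbb{P}_n$ for $\langle\cdot,\cdot\rangle$ consisting of real-valued polynomials. Quadrature rule: points $x_j\in\Omega$, weights $w_j>0$ ($j=1,\dots,m$); write $\langle v,z\rangle_m=\sum_{j=1}^m w_jv(x_j)\overline{z(x_j)}$. Exactness degree $N$ means $\sum_{j=1}^m w_jg(x_j)=\int_\Omega g\,\mathrm{d}\omega$ for all $g\in\mathbb{P}_N$. The Marcinkiewicz--Zygmund property with constant $\eta\in[0,1)$ means $\left|\sum_{j=1}^m w_j\chi(x_j)^2-\int_\Omega\chi^2\,\mathrm{d}\omega\right|\le\eta\int_\Omega\chi^2\,\mathrm{d}\omega$ for all real-valued $\chi\in\mathbb{P}_n$,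 with $\eta=0$ if $n'=n$. Hyperinterpolant of a continuous $f$: $\mathcal{L}_nf=\sum_{\ell=1}^{d_n}\langle f,p_\ell\rangle_m\,p_\ell$. Efficient hyperinterpolant of $F=Kf$ (with respect to the given factorization into $K$ and $f$): $\mathcal{S}_nF=\sum_{\ell=1}^{d_n}\left(\int_\Omega K(\mathcal{L}_nf)p_\ell\,\mathrm{d}\omega\right)p_\ell$. *)

theory Defs
  imports "HOL-Analysis.Analysis"
begin

text \<open>
  All functions are complex-valued. The scalars are a set \<open>S\<close> of complex numbers, either
  \<open>\<real>\<close> or \<open>UNIV\<close>. A function on \<open>\<Omega>\<close> is a total function of which only the values on \<open>\<Omega>\<close> matter.
\<close>

subsection \<open>The region and its measure\<close>

primrec Ck_on :: "nat \<Rightarrow> ('a::euclidean_space \<Rightarrow> 'b::real_normed_vector) \<Rightarrow> 'a set \<Rightarrow> bool" where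
  "Ck_on 0 g U \<longleftrightarrow> continuous_on U g"
| "Ck_on (Suc k) g U \<longleftrightarrow> g differentiable_on U \<and>
     (\<forall>b\<in>Basis. Ck_on k (\<lambda>x. frechet_derivative g (at x) b) U)"

definition smooth_map_on :: "('a::euclidean_space \<Rightarrow> 'b::real_normed_vector) \<Rightarrow> 'a set \<Rightarrow> bool" where
  "smooth_map_on g U \<longleftrightarrow> (\<forall>k. Ck_on k g U)"

text \<open>
  Smooth embedded submanifolds without boundary, by slice charts: near each of its points, an
  ambient diffeomorphism flattens \<open>\<Omega>\<close> onto a piece of a \<open>d\<close>-dimensional linear subspace.
\<close>

definition smooth_submanifold :: "nat \<Rightarrow> 'a::euclidean_space set \<Rightarrow> bool" where
  "smooth_submanifold d \<Omega> \<longleftrightarrow>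
     (\<forall>a\<in>\<Omega>. \<exists>U V T (\<phi> :: 'a \<Rightarrow> 'a) (\<psi> :: 'a \<Rightarrow> 'a).
        open U \<and> a \<in> U \<and> open V \<and> subspace T \<and> dim T = d \<and>
        homeomorphism U V \<phi> \<psi> \<and> smooth_map_on \<phi> U \<and> smooth_map_on \<psi> V \<and>
        \<phi> ` (U \<inter> \<Omega>) = V \<inter> T)"

definition bounded_region :: "'a::euclidean_space set \<Rightarrow> bool" where
  "bounded_region \<Omega> \<longleftrightarrow> bounded \<Omega> \<and> \<Omega> \<noteq> {} \<and>
     ((\<exists>U. open U \<and> connected U \<and> \<Omega> = closure U) \<or>
      (compact \<Omega> \<and> (\<exists>d < DIM('a). smooth_submanifold d \<Omega>)))"

text \<open>The \<open>\<sigma>\<close>-algebra may be larger than the Borel one, so completed measures are covered.\<close>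

definition region_measure :: "'a::euclidean_space set \<Rightarrow> 'a measure \<Rightarrow> bool" where
  "region_measure \<Omega> M \<longleftrightarrow>
     finite_measure M \<and> space M = \<Omega> \<and> sets (restrict_space borel \<Omega>) \<subseteq> sets M"

subsection \<open>Function spaces and norms\<close>

definition Lp_space :: "real \<Rightarrow> 'a measure \<Rightarrow> ('a \<Rightarrow> complex) set" where
  "Lp_space p M = {g \<in> borel_measurable M. integrable M (\<lambda>x. cmod (g x) powr p)}"

definition Lp_norm :: "real \<Rightarrow> 'a measure \<Rightarrow> ('a \<Rightarrow> complex) \<Rightarrow> real" where
  "Lp_norm p M g = (\<integral>x. cmod (g x) powr p \<partial>M) powr (1 / p)"

definition sup_norm :: "'a set \<Rightarrow> ('a \<Rightarrow> complex) \<Rightarrow> real" where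
  "sup_norm \<Omega> g = (SUP x\<in>\<Omega>. cmod (g x))"

definition cont_space :: "complex set \<Rightarrow> 'a::topological_space set \<Rightarrow> ('a \<Rightarrow> complex) set" where
  "cont_space S \<Omega> = {g. continuous_on \<Omega> g \<and> g ` \<Omega> \<subseteq> S}"

definition sup_op_norm ::
  "complex set \<Rightarrow> 'a::topological_space set \<Rightarrow> (('a \<Rightarrow> complex) \<Rightarrow> 'a \<Rightarrow> complex) \<Rightarrow> real" where
  "sup_op_norm S \<Omega> T = (SUP g\<in>{g \<in> cont_space S \<Omega>. sup_norm \<Omega> g \<le> 1}. sup_norm \<Omega> (T g))"

definition L2_inner :: "'a measure \<Rightarrow> ('a \<Rightarrow> complex) \<Rightarrow> ('a \<Rightarrow> complex) \<Rightarrow> complex" where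
  "L2_inner M v z = (\<integral>x. v x * cnj (z x) \<partial>M)"

text \<open>The scalars are real if both given functions are real-valued, and complex otherwise.\<close>

definition scalars_for :: "'a set \<Rightarrow> ('a \<Rightarrow> complex) \<Rightarrow> ('a \<Rightarrow> complex) \<Rightarrow> complex set" where
  "scalars_for \<Omega> K f = (if K ` \<Omega> \<subseteq> \<real> \<and> f ` \<Omega> \<subseteq> \<real> then \<real> else UNIV)"

subsection \<open>Polynomials\<close>

text \<open>A multi-index is a function \<open>\<alpha> :: 's \<Rightarrow> nat\<close> on the coordinates.\<close>

definition poly_space :: "complex set \<Rightarrow> (real ^ 's) set \<Rightarrow> nat \<Rightarrow> (real ^ 's \<Rightarrow> complex) set" where
  "poly_space S \<Omega> n =
     {g. \<exists>c :: ('s \<Rightarrow> nat) \<Rightarrow> complex. range c \<subseteq> S \<and>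
         (\<forall>x\<in>\<Omega>. g x = (\<Sum>\<alpha> | (\<Sum>i\<in>UNIV. \<alpha> i) \<le> n.
            c \<alpha> * complex_of_real (\<Prod>i\<in>UNIV. (x $ i) ^ \<alpha> i)))}"

text \<open>
  Orthonormality implies linear independence, so the number \<open>d\<close> of basis elements is necessarily
  the dimension of \<open>poly_space S \<Omega> n\<close> over \<open>S\<close>.
\<close>

definition real_orthonormal_basis ::
  "complex set \<Rightarrow> (real ^ 's) set \<Rightarrow> (real ^ 's) measure \<Rightarrow> nat \<Rightarrow> nat \<Rightarrow>
     (nat \<Rightarrow> real ^ 's \<Rightarrow> complex) \<Rightarrow> bool" where
  "real_orthonormal_basis S \<Omega> M n d p \<longleftrightarrow>
     (\<forall>l\<in>{1..d}. p l \<in> poly_space S \<Omega> n \<and> p l ` \<Omega> \<subseteq> \<real>) \<and>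
     (\<forall>k\<in>{1..d}. \<forall>l\<in>{1..d}. L2_inner M (p k) (p l) = (if k = l then 1 else 0)) \<and>
     (\<forall>g\<in>poly_space S \<Omega> n. \<exists>c. c ` {1..d} \<subseteq> S \<and> (\<forall>x\<in>\<Omega>. g x = (\<Sum>l=1..d. c l * p l x)))"

definition best_unif_err ::
  "complex set \<Rightarrow> (real ^ 's) set \<Rightarrow> nat \<Rightarrow> (real ^ 's \<Rightarrow> complex) \<Rightarrow> real" where
  "best_unif_err S \<Omega> n g = (INF q\<in>poly_space S \<Omega> n. sup_norm \<Omega> (\<lambda>x. g x - q x))"

definition best_L2_err ::
  "complex set \<Rightarrow> (real ^ 's) set \<Rightarrow> (real ^ 's) measure \<Rightarrow> nat \<Rightarrow> (real ^ 's \<Rightarrow> complex) \<Rightarrow> real" where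
  "best_L2_err S \<Omega> M n g = (INF q\<in>poly_space S \<Omega> n. Lp_norm 2 M (\<lambda>x. g x - q x))"

subsection \<open>Quadrature and hyperinterpolation\<close>

definition quadrature_rule :: "'a set \<Rightarrow> nat \<Rightarrow> (nat \<Rightarrow> 'a) \<Rightarrow> (nat \<Rightarrow> real) \<Rightarrow> bool" where
  "quadrature_rule \<Omega> m x w \<longleftrightarrow> (\<forall>j\<in>{1..m}. x j \<in> \<Omega> \<and> w j > 0)"

definition exactness_degree ::
  "complex set \<Rightarrow> (real ^ 's) set \<Rightarrow> (real ^ 's) measure \<Rightarrow> nat \<Rightarrow> (nat \<Rightarrow> real ^ 's) \<Rightarrow>
     (nat \<Rightarrow> real) \<Rightarrow> nat \<Rightarrow> bool" where
  "exactness_degree S \<Omega> M m x w N \<longleftrightarrow>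
     (\<forall>g\<in>poly_space S \<Omega> N. (\<Sum>j=1..m. complex_of_real (w j) * g (x j)) = (\<integral>y. g y \<partial>M))"

definition MZ_property ::
  "complex set \<Rightarrow> (real ^ 's) set \<Rightarrow> (real ^ 's) measure \<Rightarrow> nat \<Rightarrow> (nat \<Rightarrow> real ^ 's) \<Rightarrow>
     (nat \<Rightarrow> real) \<Rightarrow> nat \<Rightarrow> nat \<Rightarrow> real \<Rightarrow> bool" where
  "MZ_property S \<Omega> M m x w n n' \<eta> \<longleftrightarrow>
     0 \<le> \<eta> \<and> \<eta> < 1 \<and> (n' = n \<longrightarrow> \<eta> = 0) \<and>
     (\<forall>q :: real ^ 's \<Rightarrow> real. (\<lambda>y. complex_of_real (q y)) \<in> poly_space S \<Omega> n \<longrightarrow>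
        \<bar>(\<Sum>j=1..m. w j * (q (x j))\<^sup>2) - (\<integral>y. (q y)\<^sup>2 \<partial>M)\<bar> \<le> \<eta> * (\<integral>y. (q y)\<^sup>2 \<partial>M))"

definition discrete_inner ::
  "nat \<Rightarrow> (nat \<Rightarrow> 'a) \<Rightarrow> (nat \<Rightarrow> real) \<Rightarrow> ('a \<Rightarrow> complex) \<Rightarrow> ('a \<Rightarrow> complex) \<Rightarrow> complex" where
  "discrete_inner m x w v z = (\<Sum>j=1..m. complex_of_real (w j) * v (x j) * cnj (z (x j)))"

definition hyperinterp ::
  "nat \<Rightarrow> (nat \<Rightarrow> 'a) \<Rightarrow> (nat \<Rightarrow> real) \<Rightarrow> nat \<Rightarrow> (nat \<Rightarrow> 'a \<Rightarrow> complex) \<Rightarrow>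
     ('a \<Rightarrow> complex) \<Rightarrow> 'a \<Rightarrow> complex" where
  "hyperinterp m x w d p g = (\<lambda>y. \<Sum>l=1..d. discrete_inner m x w g (p l) * p l y)"

definition efficient_hyperinterp ::
  "'a measure \<Rightarrow> nat \<Rightarrow> (nat \<Rightarrow> 'a) \<Rightarrow> (nat \<Rightarrow> real) \<Rightarrow> nat \<Rightarrow> (nat \<Rightarrow> 'a \<Rightarrow> complex) \<Rightarrow>
     ('a \<Rightarrow> complex) \<Rightarrow> ('a \<Rightarrow> complex) \<Rightarrow> 'a \<Rightarrow> complex" where
  "efficient_hyperinterp M m x w d p K f =
     (\<lambda>y. \<Sum>l=1..d. (\<integral>z. K z * hyperinterp m x w d p f z * p l z \<partial>M) * p l y)"

end

theory Submission
  imports Defs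
begin

text \<open>
  \<open>S\<^sub>n F\<close> is the orthogonal projection of \<open>K (L\<^sub>n f)\<close> onto the polynomials of degree \<open>n\<close>, which gives
  the stability bound. Exactness of degree \<open>n + n'\<close> makes \<open>L\<^sub>n\<close> reproduce every polynomial \<open>q\<close> of degree \<open>n'\<close>, so
  \<open>S\<^sub>n F - F\<close> splits into the projection of \<open>K L\<^sub>n (f - q)\<close>, the projection error of \<open>K q\<close>
  (which is at most the best \<open>L\<^sup>2\<close> error), and \<open>K (q - f)\<close>.
\<close>

subsection \<open>Square-integrable functions\<close>

lemma Lp_space_2_iff:
  "g \<in> Lp_space 2 M \<longleftrightarrow> g \<in> borel_measurable M \<and> integrable M (\<lambda>x. (cmod (g x))\<^sup>2)"
  by (simp add: Lp_space_def)

lemma Lp_norm_2_eq: "Lp_norm 2 M g = sqrt (\<integral>x. (cmod (g x))\<^sup>2 \<partial>M)"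
  by (simp add: Lp_norm_def powr_half_sqrt)

lemma Lp_norm_2_power2: "(Lp_norm 2 M g)\<^sup>2 = (\<integral>x. (cmod (g x))\<^sup>2 \<partial>M)"
  by (simp add: Lp_norm_2_eq)

lemma Lp_norm_nonneg: "0 \<le> Lp_norm r M g"
  by (simp add: Lp_norm_def)

text \<open>The sum of the two squared moduli is an integrable majorant of the product. Without
  integrability, the integral in \<open>L2_inner\<close> would only have the default value
  0.\<close>

lemma L2_integrable_mult:
  assumes "v \<in> Lp_space 2 M" "z \<in> Lp_space 2 M"
  shows "integrable M (\<lambda>x. v x * cnj (z x))"
proof (rule Bochner_Integration.integrable_bound)
  show "integrable M (\<lambda>x. (cmod (v x))\<^sup>2 + (cmod (z x))\<^sup>2)"
    using assms by (simp add: Lp_space_2_iff)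
  show "(\<lambda>x. v x * cnj (z x)) \<in> borel_measurable M"
    using assms by (auto simp: Lp_space_2_iff
        intro!: borel_measurable_times borel_measurable_continuous_on[of cnj] continuous_on_cnj continuous_on_id)
  have "cmod (v x) * cmod (z x) \<le> (cmod (v x))\<^sup>2 + (cmod (z x))\<^sup>2" for x
  proof -
    have "2 * (cmod (v x) * cmod (z x)) \<le> (cmod (v x))\<^sup>2 + (cmod (z x))\<^sup>2"
      using sum_squares_bound[of "cmod (v x)" "cmod (z x)"] by (simp add: mult.assoc)
    moreover have "0 \<le> cmod (v x) * cmod (z x)"
      by simp
    ultimately show ?thesis
      by linarith
  qed
  then show "AE x in M. norm (v x * cnj (z x)) \<le> norm ((cmod (v x))\<^sup>2 + (cmod (z x))\<^sup>2)"
    by (simp add: norm_mult)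
qed

lemma L2_add:
  assumes "v \<in> Lp_space 2 M" "z \<in> Lp_space 2 M"
  shows "(\<lambda>x. v x + z x) \<in> Lp_space 2 M"
proof -
  have "integrable M (\<lambda>x. (cmod (v x + z x))\<^sup>2)"
  proof (rule Bochner_Integration.integrable_bound)
    show "integrable M (\<lambda>x. 2 * (cmod (v x))\<^sup>2 + 2 * (cmod (z x))\<^sup>2)"
      using assms by (simp add: Lp_space_2_iff)
    show "(\<lambda>x. (cmod (v x + z x))\<^sup>2) \<in> borel_measurable M"
      using assms by (auto simp: Lp_space_2_iff intro!: borel_measurable_power borel_measurable_norm)
    have "(cmod (v x + z x))\<^sup>2 \<le> 2 * (cmod (v x))\<^sup>2 + 2 * (cmod (z x))\<^sup>2" for x
    proof -
      have "(cmod (v x + z x))\<^sup>2 \<le> (cmod (v x) + cmod (z x))\<^sup>2"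
        by (intro power_mono norm_triangle_ineq norm_ge_zero)
      also have "\<dots> \<le> 2 * (cmod (v x))\<^sup>2 + 2 * (cmod (z x))\<^sup>2"
        using sum_squares_bound[of "cmod (v x)" "cmod (z x)"] by (simp add: power2_sum)
      finally show ?thesis .
    qed
    then show "AE x in M. norm ((cmod (v x + z x))\<^sup>2)
        \<le> norm (2 * (cmod (v x))\<^sup>2 + 2 * (cmod (z x))\<^sup>2)"
      by simp
  qed
  with assms show ?thesis
    by (auto simp: Lp_space_2_iff)
qed

text \<open>Multiplication by a bounded function acts on square-integrable functions; this is how
  \<open>K\<close> is combined with continuous factors. The condition \<open>0 \<le> c\<close> turns
  \<open>sqrt (c\<^sup>2)\<close> into \<open>c\<close>.\<close>

lemma
  assumes "g \<in> Lp_space 2 M" "u \<in> borel_measurable M" "\<And>x. x \<in> space M \<Longrightarrow> cmod (u x) \<le> c"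
  shows L2_mult_bounded: "(\<lambda>x. g x * u x) \<in> Lp_space 2 M"
    and Lp_norm_2_mult_bounded: "0 \<le> c \<Longrightarrow> Lp_norm 2 M (\<lambda>x. g x * u x) \<le> Lp_norm 2 M g * c"
proof -
  have le: "(cmod (g x * u x))\<^sup>2 \<le> (cmod (g x))\<^sup>2 * c\<^sup>2" if "x \<in> space M" for x
    using assms(3)[OF that] by (auto simp: norm_mult power_mult_distrib intro!: mult_left_mono power_mono)
  have int: "integrable M (\<lambda>x. (cmod (g x))\<^sup>2 * c\<^sup>2)"
    using assms by (simp add: Lp_space_2_iff)
  have int': "integrable M (\<lambda>x. (cmod (g x * u x))\<^sup>2)"
    using assms(1,2) le by (intro Bochner_Integration.integrable_bound[OF int]) (auto simp: Lp_space_2_iff)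
  then show "(\<lambda>x. g x * u x) \<in> Lp_space 2 M"
    using assms(1,2) by (auto simp: Lp_space_2_iff)
  assume "0 \<le> c"
  have "(\<integral>x. (cmod (g x * u x))\<^sup>2 \<partial>M) \<le> (\<integral>x. (cmod (g x))\<^sup>2 * c\<^sup>2 \<partial>M)"
    using le by (intro integral_mono int int')
  then show "Lp_norm 2 M (\<lambda>x. g x * u x) \<le> Lp_norm 2 M g * c"
    using real_sqrt_le_mono \<open>0 \<le> c\<close> by (fastforce simp: Lp_norm_2_eq real_sqrt_mult)
qed

lemma L2_scale: "g \<in> Lp_space 2 M \<Longrightarrow> (\<lambda>x. c * g x) \<in> Lp_space 2 M"
  using L2_mult_bounded[of g M "\<lambda>_. c" "cmod c"] by (simp add: mult.commute)

lemma L2_diff: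
  "v \<in> Lp_space 2 M \<Longrightarrow> z \<in> Lp_space 2 M \<Longrightarrow> (\<lambda>x. v x - z x) \<in> Lp_space 2 M"
  using L2_add[of v M "\<lambda>x. - 1 * z x"] L2_scale[of z M "- 1"] by simp

lemma L2_sum:
  "(\<And>i. i \<in> I \<Longrightarrow> g i \<in> Lp_space 2 M) \<Longrightarrow> (\<lambda>x. \<Sum>i\<in>I. g i x) \<in> Lp_space 2 M"
  by (induction I rule: infinite_finite_induct) (auto simp: L2_add, auto simp: Lp_space_2_iff)

text \<open>Minkowski's inequality, obtained from convexity of the square with weights proportional
  to the two norms instead of from Cauchy-Schwarz.\<close>

lemma Lp_norm_2_triangle:
  assumes "v \<in> Lp_space 2 M" "z \<in> Lp_space 2 M"
  shows "Lp_norm 2 M (\<lambda>x. v x + z x) \<le> Lp_norm 2 M v + Lp_norm 2 M z"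
proof (rule field_le_epsilon)
  fix e :: real
  assume "0 < e"
  \<comment> \<open>Either norm may vanish; adding \<open>e / 2\<close> keeps both denominators
    positive, and the total excess is exactly \<open>e\<close>.\<close>
  define A where "A = Lp_norm 2 M v + e / 2"
  define B where "B = Lp_norm 2 M z + e / 2"
  have pos: "0 < A" "0 < B"
    using \<open>0 < e\<close> Lp_norm_nonneg[of 2 M v] Lp_norm_nonneg[of 2 M z] by (simp_all add: A_def B_def)
  have A: "(\<integral>x. (cmod (v x))\<^sup>2 \<partial>M) \<le> A\<^sup>2" and B: "(\<integral>x. (cmod (z x))\<^sup>2 \<partial>M) \<le> B\<^sup>2"
    unfolding Lp_norm_2_power2[symmetric] A_def B_def
    using \<open>0 < e\<close> by (intro power_mono Lp_norm_nonneg; simp)+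
  \<comment> \<open>convexity of the square, with weights \<open>A / (A + B)\<close> and \<open>B / (A + B)\<close>\<close>
  have convex: "(a + b)\<^sup>2 \<le> (A + B) * (a\<^sup>2 / A + b\<^sup>2 / B)" for a b :: real
  proof -
    have "(A + B) * (a\<^sup>2 / A + b\<^sup>2 / B) - (a + b)\<^sup>2 = (a * B - b * A)\<^sup>2 / (A * B)"
      using pos by (simp add: field_simps power2_eq_square)
    also have "\<dots> \<ge> 0"
      using pos by simp
    finally show ?thesis
      by simp
  qed
  have "(\<integral>x. (cmod (v x + z x))\<^sup>2 \<partial>M)
      \<le> (\<integral>x. (A + B) * ((cmod (v x))\<^sup>2 / A + (cmod (z x))\<^sup>2 / B) \<partial>M)"
  proof (rule integral_mono)
    show "(cmod (v x + z x))\<^sup>2 \<le> (A + B) * ((cmod (v x))\<^sup>2 / A + (cmod (z x))\<^sup>2 / B)" for x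
      by (rule order_trans[OF _ convex]) (intro power_mono norm_triangle_ineq norm_ge_zero)
  qed (use assms L2_add[OF assms] in \<open>auto simp: Lp_space_2_iff\<close>)
  also have "\<dots> = (A + B) * ((\<integral>x. (cmod (v x))\<^sup>2 \<partial>M) / A + (\<integral>x. (cmod (z x))\<^sup>2 \<partial>M) / B)"
    using assms by (simp add: Lp_space_2_iff)
  also have "\<dots> \<le> (A + B) * (A\<^sup>2 / A + B\<^sup>2 / B)"
    using pos A B by (intro mult_left_mono add_mono divide_right_mono) auto
  also have "\<dots> = (A + B)\<^sup>2"
    using pos by (simp add: power2_eq_square)
  finally have "Lp_norm 2 M (\<lambda>x. v x + z x) \<le> A + B"
    using pos by (simp add: Lp_norm_2_eq real_le_lsqrt)
  then show "Lp_norm 2 M (\<lambda>x. v x + z x) \<le> Lp_norm 2 M v + Lp_norm 2 M z + e"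
    by (simp add: A_def B_def)
qed

lemma Lp_norm_cong:
  "(\<And>x. x \<in> space M \<Longrightarrow> cmod (g x) = cmod (h x)) \<Longrightarrow> Lp_norm r M g = Lp_norm r M h"
  by (simp add: Lp_norm_def cong: Bochner_Integration.integral_cong)

subsection \<open>Orthogonal projection\<close>

text \<open>Completing the square in each coefficient. Only the last sum depends on
  \<open>c\<close>, so the Fourier coefficients minimise the distance.\<close>

lemma L2_dist_orthonormal_combination:
  assumes "finite I" and e: "\<And>i. i \<in> I \<Longrightarrow> e i \<in> Lp_space 2 M"
    and on: "\<And>i j. i \<in> I \<Longrightarrow> j \<in> I \<Longrightarrow> L2_inner M (e i) (e j) = (if i = j then 1 else 0)"
    and g: "g \<in> Lp_space 2 M"
  shows "(Lp_norm 2 M (\<lambda>x. g x - (\<Sum>i\<in>I. c i * e i x)))\<^sup>2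
    = (Lp_norm 2 M g)\<^sup>2 - (\<Sum>i\<in>I. (cmod (L2_inner M g (e i)))\<^sup>2)
      + (\<Sum>i\<in>I. (cmod (c i - L2_inner M g (e i)))\<^sup>2)"
proof -
  define s where "s x = (\<Sum>i\<in>I. c i * e i x)" for x
  define a where "a i = L2_inner M g (e i)" for i
  have s: "s \<in> Lp_space 2 M"
    unfolding s_def by (intro L2_sum L2_scale e)
  have int: "integrable M (\<lambda>x. h x * cnj (e i x))" if "h \<in> Lp_space 2 M" "i \<in> I" for h i
    using that by (intro L2_integrable_mult e)
  have gs: "(\<integral>x. g x * cnj (s x) \<partial>M) = (\<Sum>i\<in>I. cnj (c i) * a i)"
  proof -
    have "(\<integral>x. g x * cnj (s x) \<partial>M) = (\<integral>x. (\<Sum>i\<in>I. cnj (c i) * (g x * cnj (e i x))) \<partial>M)"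
      by (simp add: s_def sum_distrib_left mult_ac)
    also have "\<dots> = (\<Sum>i\<in>I. \<integral>x. cnj (c i) * (g x * cnj (e i x)) \<partial>M)"
      by (intro Bochner_Integration.integral_sum integrable_mult_right int g)
    finally show ?thesis
      by (simp add: a_def L2_inner_def)
  qed
  have se: "(\<integral>x. s x * cnj (e i x) \<partial>M) = c i" if "i \<in> I" for i
  proof -
    have "(\<integral>x. s x * cnj (e i x) \<partial>M) = (\<integral>x. (\<Sum>j\<in>I. c j * (e j x * cnj (e i x))) \<partial>M)"
      by (simp add: s_def sum_distrib_right mult.assoc)
    also have "\<dots> = (\<Sum>j\<in>I. \<integral>x. c j * (e j x * cnj (e i x)) \<partial>M)"
      using that by (intro Bochner_Integration.integral_sum integrable_mult_right int e)
    also have "\<dots> = (\<Sum>j\<in>I. c j * L2_inner M (e j) (e i))"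
      by (simp add: L2_inner_def)
    also have "\<dots> = (\<Sum>j\<in>I. if j = i then c j else 0)"
      using that by (intro sum.cong) (auto simp: on)
    finally show ?thesis
      using that \<open>finite I\<close> by simp
  qed
  have ss: "(\<integral>x. s x * cnj (s x) \<partial>M) = (\<Sum>i\<in>I. cnj (c i) * c i)"
  proof -
    have "(\<integral>x. s x * cnj (s x) \<partial>M) = (\<integral>x. (\<Sum>i\<in>I. cnj (c i) * (s x * cnj (e i x))) \<partial>M)"
      \<comment> \<open>Only the conjugated factor is expanded; the other stays \<open>s\<close>, so
        that \<open>se\<close> evaluates the resulting integrals.\<close>
      by (subst (2) s_def) (simp add: sum_distrib_left mult_ac)
    also have "\<dots> = (\<Sum>i\<in>I. \<integral>x. cnj (c i) * (s x * cnj (e i x)) \<partial>M)"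
      by (intro Bochner_Integration.integral_sum integrable_mult_right int s)
    finally show ?thesis
      by (simp add: se)
  qed
  \<comment> \<open>The last two terms are written as real parts so that their integrals become the
    real parts of the complex integrals \<open>gs\<close> and \<open>ss\<close>.\<close>
  have sq: "(cmod (u - v))\<^sup>2 = (cmod u)\<^sup>2 - 2 * Re (u * cnj v) + Re (v * cnj v)" for u v
    unfolding cmod_power2 by (simp add: power2_eq_square algebra_simps)
  note igs = L2_integrable_mult[OF g s] and iss = L2_integrable_mult[OF s s]
  have "(Lp_norm 2 M (\<lambda>x. g x - s x))\<^sup>2
      = (\<integral>x. (cmod (g x))\<^sup>2 - 2 * Re (g x * cnj (s x)) + Re (s x * cnj (s x)) \<partial>M)"
    by (simp only: Lp_norm_2_power2 sq)
  also have "\<dots> = (\<integral>x. (cmod (g x))\<^sup>2 \<partial>M) - 2 * (\<integral>x. Re (g x * cnj (s x)) \<partial>M)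
      + (\<integral>x. Re (s x * cnj (s x)) \<partial>M)"
    using g integrable_Re[OF igs] integrable_Re[OF iss]
    by (simp add: Lp_space_2_iff del: times_complex.simps)
  also have "\<dots> = (Lp_norm 2 M g)\<^sup>2 - 2 * Re (\<Sum>i\<in>I. cnj (c i) * a i) + Re (\<Sum>i\<in>I. cnj (c i) * c i)"
    unfolding Lp_norm_2_power2 integral_Re[OF igs] integral_Re[OF iss] gs ss ..
  also have "\<dots> = (Lp_norm 2 M g)\<^sup>2 - (\<Sum>i\<in>I. (cmod (a i))\<^sup>2) + (\<Sum>i\<in>I. (cmod (c i - a i))\<^sup>2)"
  proof -
    have "(\<Sum>i\<in>I. (cmod (c i - a i))\<^sup>2)
        = (\<Sum>i\<in>I. Re (cnj (c i) * c i) - 2 * Re (cnj (c i) * a i) + (cmod (a i))\<^sup>2)"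
      unfolding cmod_power2
      by (intro sum.cong refl) (simp add: power2_eq_square algebra_simps)
    then show ?thesis
      by (simp add: sum.distrib sum_subtractf sum_distrib_left)
  qed
  finally show ?thesis
    by (simp add: s_def a_def)
qed

text \<open>Both bounds are read off the distance identity. With the Fourier coefficients its last
  sum vanishes, and what remains is at most the value for any other \<open>c\<close>.\<close>

lemma
  assumes "finite I" and e: "\<And>i. i \<in> I \<Longrightarrow> e i \<in> Lp_space 2 M"
    and on: "\<And>i j. i \<in> I \<Longrightarrow> j \<in> I \<Longrightarrow> L2_inner M (e i) (e j) = (if i = j then 1 else 0)"
    and g: "g \<in> Lp_space 2 M"
  shows L2_projection_norm_le:
      "Lp_norm 2 M (\<lambda>x. \<Sum>i\<in>I. L2_inner M g (e i) * e i x) \<le> Lp_norm 2 M g" (is ?norm)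
    and L2_projection_best:
      "Lp_norm 2 M (\<lambda>x. g x - (\<Sum>i\<in>I. L2_inner M g (e i) * e i x))
        \<le> Lp_norm 2 M (\<lambda>x. g x - (\<Sum>i\<in>I. c i * e i x))" (is ?best)
proof -
  note dist = L2_dist_orthonormal_combination[OF \<open>finite I\<close> e on]
  let ?P = "\<lambda>x. \<Sum>i\<in>I. L2_inner M g (e i) * e i x"
  have "(Lp_norm 2 M (\<lambda>x. g x - ?P x))\<^sup>2
      = (Lp_norm 2 M g)\<^sup>2 - (\<Sum>i\<in>I. (cmod (L2_inner M g (e i)))\<^sup>2)"
    using dist[OF _ _ _ g, of "\<lambda>i. L2_inner M g (e i)"] by simp
  moreover have "(Lp_norm 2 M ?P)\<^sup>2 = (\<Sum>i\<in>I. (cmod (L2_inner M g (e i)))\<^sup>2)"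
  \<comment> \<open>Pythagoras: the distance identity for the zero function, whose own Fourier
    coefficients vanish, computes the norm of \<open>?P\<close>.\<close>
  proof -
    have z: "(\<lambda>_. 0) \<in> Lp_space 2 M"
      by (simp add: Lp_space_2_iff)
    have "L2_inner M (\<lambda>_. 0) (e i) = 0" for i
      by (simp add: L2_inner_def)
    then show ?thesis
      using dist[OF _ _ _ z, of "\<lambda>i. L2_inner M g (e i)"] by (simp add: Lp_norm_2_power2)
  qed
  ultimately have "(Lp_norm 2 M ?P)\<^sup>2 \<le> (Lp_norm 2 M g)\<^sup>2"
    using zero_le_power2[of "Lp_norm 2 M (\<lambda>x. g x - ?P x)"] by linarith
  then show ?norm
    using Lp_norm_nonneg power2_le_imp_le by blast
  have "(Lp_norm 2 M (\<lambda>x. g x - ?P x))\<^sup>2 \<le> (Lp_norm 2 M (\<lambda>x. g x - (\<Sum>i\<in>I. c i * e i x)))\<^sup>2"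
    by (simp add: dist[OF _ _ _ g] sum_nonneg)
  then show ?best
    using Lp_norm_nonneg power2_le_imp_le by blast
qed

subsection \<open>The supremum norm\<close>

text \<open>A real \<open>SUP\<close> bounds its set only if that set is bounded above; compactness
  and continuity supply this.\<close>

lemma cmod_le_sup_norm:
  assumes "compact \<Omega>" "continuous_on \<Omega> g" "y \<in> \<Omega>"
  shows "cmod (g y) \<le> sup_norm \<Omega> g"
proof -
  have "bdd_above ((\<lambda>y. cmod (g y)) ` \<Omega>)"
    using assms by (intro bounded_imp_bdd_above compact_imp_bounded compact_continuous_image continuous_on_norm)
  then show ?thesis
    using \<open>y \<in> \<Omega>\<close> by (auto simp: sup_norm_def intro: cSUP_upper)
qed

lemma sup_norm_le: "\<Omega> \<noteq> {} \<Longrightarrow> (\<And>y. y \<in> \<Omega> \<Longrightarrow> cmod (g y) \<le> c) \<Longrightarrow> sup_norm \<Omega> g \<le> c"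
  by (auto simp: sup_norm_def intro: cSUP_least)

lemma sup_norm_nonneg:
  "compact \<Omega> \<Longrightarrow> \<Omega> \<noteq> {} \<Longrightarrow> continuous_on \<Omega> g \<Longrightarrow> 0 \<le> sup_norm \<Omega> g"
  using cmod_le_sup_norm norm_ge_zero order_trans by blast

lemma sup_norm_scaleR_le:
  assumes "compact \<Omega>" "\<Omega> \<noteq> {}" "continuous_on \<Omega> g"
  shows "sup_norm \<Omega> (\<lambda>y. complex_of_real c * g y) \<le> \<bar>c\<bar> * sup_norm \<Omega> g"
  using assms by (auto simp: norm_mult intro!: sup_norm_le mult_left_mono cmod_le_sup_norm)

subsection \<open>Polynomials\<close>

text \<open>Each exponent is at most the total degree, so the multi-indices lie in a finite box.
  Finiteness matters because a sum over an infinite set is 0 by convention.\<close>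

lemma finite_multi_indices:
  "finite {\<alpha> :: 's::finite \<Rightarrow> nat. (\<Sum>i\<in>UNIV. \<alpha> i) \<le> n}" (is "finite ?A")
proof (rule finite_subset)
  have "\<alpha> i \<le> n" if "(\<Sum>i\<in>UNIV. \<alpha> i) \<le> n" for \<alpha> :: "'s \<Rightarrow> nat" and i
    using member_le_sum[of i UNIV \<alpha>] that by simp
  then show "?A \<subseteq> PiE UNIV (\<lambda>_. {..n})"
    by auto
  show "finite (PiE (UNIV :: 's set) (\<lambda>_. {..n}))"
    by (intro finite_PiE) auto
qed

lemma continuous_on_poly_space:
  assumes "g \<in> poly_space S \<Omega> n"
  shows "continuous_on \<Omega> g"
proof -
  obtain c where c: "\<forall>y\<in>\<Omega>. g y = (\<Sum>\<alpha> | (\<Sum>i\<in>UNIV. \<alpha> i) \<le> n.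
      c \<alpha> * complex_of_real (\<Prod>i\<in>UNIV. (y $ i) ^ \<alpha> i))"
    using assms unfolding poly_space_def by blast
  have "continuous_on \<Omega> (\<lambda>y. \<Sum>\<alpha> | (\<Sum>i\<in>UNIV. \<alpha> i) \<le> n.
      c \<alpha> * complex_of_real (\<Prod>i\<in>UNIV. (y $ i) ^ \<alpha> i))"
    by (intro continuous_intros)
  with c show ?thesis
    by (metis (no_types, lifting) continuous_on_cong)
qed

lemma poly_space_Reals:
  assumes "g \<in> poly_space \<real> \<Omega> n"
  shows "g ` \<Omega> \<subseteq> \<real>"
proof -
  obtain c where "range c \<subseteq> \<real>" and c: "\<forall>y\<in>\<Omega>. g y = (\<Sum>\<alpha> | (\<Sum>i\<in>UNIV. \<alpha> i) \<le> n.
      c \<alpha> * complex_of_real (\<Prod>i\<in>UNIV. (y $ i) ^ \<alpha> i))"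
    using assms unfolding poly_space_def by blast
  then have "c \<alpha> \<in> \<real>" for \<alpha>
    by auto
  with c show ?thesis
    by auto
qed

lemma poly_space_mono:
  fixes \<Omega> :: "(real ^ 's) set"
  assumes "0 \<in> S" "k \<le> n"
  shows "poly_space S \<Omega> k \<subseteq> poly_space S \<Omega> n"
proof
  fix q
  assume "q \<in> poly_space S \<Omega> k"
  then obtain c where c: "range c \<subseteq> S" "\<forall>y\<in>\<Omega>. q y = (\<Sum>\<alpha> | (\<Sum>i\<in>UNIV. \<alpha> i) \<le> k.
      c \<alpha> * complex_of_real (\<Prod>i\<in>UNIV. (y $ i) ^ \<alpha> i))"
    unfolding poly_space_def by blast
  \<comment> \<open>The coefficients beyond degree \<open>k\<close> may be arbitrary in
    \<open>c\<close>, so they are reset to 0 before the range of summation grows.\<close>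
  define c' where "c' \<alpha> = (if (\<Sum>i\<in>UNIV. \<alpha> i) \<le> k then c \<alpha> else 0)" for \<alpha> :: "'s \<Rightarrow> nat"
  have "(\<Sum>\<alpha> | (\<Sum>i\<in>UNIV. \<alpha> i) \<le> k. c \<alpha> * complex_of_real (\<Prod>i\<in>UNIV. (y $ i) ^ \<alpha> i))
      = (\<Sum>\<alpha> | (\<Sum>i\<in>UNIV. \<alpha> i) \<le> n. c' \<alpha> * complex_of_real (\<Prod>i\<in>UNIV. (y $ i) ^ \<alpha> i))"
    for y :: "real ^ 's"
  proof (rule sum.mono_neutral_cong_left[OF finite_multi_indices])
    show "{\<alpha> :: 's \<Rightarrow> nat. (\<Sum>i\<in>UNIV. \<alpha> i) \<le> k} \<subseteq> {\<alpha>. (\<Sum>i\<in>UNIV. \<alpha> i) \<le> n}"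
      using \<open>k \<le> n\<close> by (intro Collect_mono impI) (rule order_trans)
  qed (simp_all add: c'_def)
  with c(2) have "\<forall>y\<in>\<Omega>. q y = (\<Sum>\<alpha> | (\<Sum>i\<in>UNIV. \<alpha> i) \<le> n.
      c' \<alpha> * complex_of_real (\<Prod>i\<in>UNIV. (y $ i) ^ \<alpha> i))"
    by (simp only: ball_simps)
  moreover have "range c' \<subseteq> S"
    using c(1) \<open>0 \<in> S\<close> by (auto simp: c'_def)
  ultimately show "q \<in> poly_space S \<Omega> n"
    unfolding poly_space_def by blast
qed

text \<open>The coefficients of the product are the convolution of the two coefficient families. The
  closure conditions on \<open>S\<close> keep them scalars.\<close>

lemma poly_space_mult:
  fixes \<Omega> :: "(real ^ 's) set"
  assumes "g \<in> poly_space S \<Omega> a" "h \<in> poly_space S \<Omega> b"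
    and "0 \<in> S" and add: "\<And>u v. u \<in> S \<Longrightarrow> v \<in> S \<Longrightarrow> u + v \<in> S"
    and mult: "\<And>u v. u \<in> S \<Longrightarrow> v \<in> S \<Longrightarrow> u * v \<in> S"
  shows "(\<lambda>y. g y * h y) \<in> poly_space S \<Omega> (a + b)"
proof -
  define mon where "mon \<alpha> y = complex_of_real (\<Prod>i\<in>UNIV. (y $ i) ^ \<alpha> i)"
    for \<alpha> and y :: "real ^ 's"
  define A where "A k = {\<alpha> :: 's \<Rightarrow> nat. (\<Sum>i\<in>UNIV. \<alpha> i) \<le> k}" for k
  have fin: "finite (A k)" for k
    unfolding A_def by (rule finite_multi_indices)
  have expand: "\<exists>c. range c \<subseteq> S \<and> (\<forall>y\<in>\<Omega>. u y = (\<Sum>\<alpha>\<in>A k. c \<alpha> * mon \<alpha> y))"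
    if "u \<in> poly_space S \<Omega> k" for u k
    using that unfolding poly_space_def mem_Collect_eq A_def mon_def .
  obtain c where c: "range c \<subseteq> S" and g: "\<forall>y\<in>\<Omega>. g y = (\<Sum>\<alpha>\<in>A a. c \<alpha> * mon \<alpha> y)"
    using expand[OF assms(1)] by blast
  obtain c' where c': "range c' \<subseteq> S" and h: "\<forall>y\<in>\<Omega>. h y = (\<Sum>\<alpha>\<in>A b. c' \<alpha> * mon \<alpha> y)"
    using expand[OF assms(2)] by blast
  \<comment> \<open>The convolution is summed over all index pairs with an indicator, so that the
    sums over \<open>\<gamma>\<close> and over pairs can be exchanged.\<close>
  define C where
    "C \<gamma> = (\<Sum>(\<alpha>, \<beta>)\<in>A a \<times> A b. if (\<lambda>i. \<alpha> i + \<beta> i) = \<gamma> then c \<alpha> * c' \<beta> else 0)" for \<gamma>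
  have sum_S: "(\<Sum>i\<in>I. t i) \<in> S" if "\<And>i. i \<in> I \<Longrightarrow> t i \<in> S" for I and t :: "('s \<Rightarrow> nat) \<times> ('s \<Rightarrow> nat) \<Rightarrow> complex"
    using that by (induction I rule: infinite_finite_induct) (auto intro: add \<open>0 \<in> S\<close>)
  have "c \<alpha> * c' \<beta> \<in> S" for \<alpha> \<beta>
    using c c' by (intro mult) auto
  then have "range C \<subseteq> S"
    using \<open>0 \<in> S\<close> by (auto simp: C_def intro!: sum_S)
  moreover have "g y * h y = (\<Sum>\<gamma>\<in>A (a + b). C \<gamma> * mon \<gamma> y)" if "y \<in> \<Omega>" for y
  proof -
    have "(\<Sum>\<gamma>\<in>A (a + b). C \<gamma> * mon \<gamma> y) = (\<Sum>\<gamma>\<in>A (a + b). \<Sum>(\<alpha>, \<beta>)\<in>A a \<times> A b.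
        if (\<lambda>i. \<alpha> i + \<beta> i) = \<gamma> then c \<alpha> * c' \<beta> * mon \<gamma> y else 0)"
      unfolding C_def sum_distrib_right by (intro sum.cong refl) (auto split: if_splits)
    also have "\<dots> = (\<Sum>(\<alpha>, \<beta>)\<in>A a \<times> A b. \<Sum>\<gamma>\<in>A (a + b).
        if (\<lambda>i. \<alpha> i + \<beta> i) = \<gamma> then c \<alpha> * c' \<beta> * mon \<gamma> y else 0)"
      by (subst sum.swap) (simp add: case_prod_unfold)
    also have "\<dots> = (\<Sum>(\<alpha>, \<beta>)\<in>A a \<times> A b. (c \<alpha> * mon \<alpha> y) * (c' \<beta> * mon \<beta> y))"
    proof (intro sum.cong refl, clarify)
      fix \<alpha> \<beta>
      assume "\<alpha> \<in> A a" "\<beta> \<in> A b"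
      \<comment> \<open>Total degrees add, so the one index \<open>\<gamma>\<close> selected by the
        indicator does occur in the inner sum.\<close>
      then have "(\<lambda>i. \<alpha> i + \<beta> i) \<in> A (a + b)"
        by (simp add: A_def sum.distrib)
      moreover have "mon (\<lambda>i. \<alpha> i + \<beta> i) y = mon \<alpha> y * mon \<beta> y"
        by (simp add: mon_def power_add prod.distrib)
      ultimately show "(\<Sum>\<gamma>\<in>A (a + b). if (\<lambda>i. \<alpha> i + \<beta> i) = \<gamma> then c \<alpha> * c' \<beta> * mon \<gamma> y else 0)
          = (c \<alpha> * mon \<alpha> y) * (c' \<beta> * mon \<beta> y)"
        by (simp add: fin mult_ac)
    qed
    also have "\<dots> = g y * h y"
      by (simp add: g h that sum_product sum.cartesian_product)
    finally show ?thesis ..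
  qed
  ultimately show ?thesis
    unfolding poly_space_def mem_Collect_eq A_def mon_def by (intro exI[of _ C] conjI ballI)
qed

section \<open>Scalars and the real orthonormal basis\<close>

lemma scalars_for_closed:
  assumes "S = scalars_for \<Omega> K f"
  shows "0 \<in> S" "u \<in> S \<Longrightarrow> v \<in> S \<Longrightarrow> u + v \<in> S" "u \<in> S \<Longrightarrow> v \<in> S \<Longrightarrow> u - v \<in> S"
    "u \<in> S \<Longrightarrow> v \<in> S \<Longrightarrow> u * v \<in> S" "complex_of_real r \<in> S" "f ` \<Omega> \<subseteq> S"
  using assms by (auto simp: scalars_for_def split: if_splits)

lemma poly_space_scalars:
  assumes "S = scalars_for \<Omega> K f" "q \<in> poly_space S \<Omega> n"
  shows "q ` \<Omega> \<subseteq> S"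
  using assms poly_space_Reals[of q \<Omega> n] by (auto simp: scalars_for_def split: if_splits)

text \<open>Reality of the basis lets conjugates be dropped: exactness concerns products of
  polynomials without conjugation, and \<open>efficient_hyperinterp\<close> integrates against
  \<open>p l\<close> itself.\<close>

lemma real_orthonormal_basis_cnj:
  assumes "real_orthonormal_basis S \<Omega> M n d p" "l \<in> {1..d}" "y \<in> \<Omega>"
  shows "cnj (p l y) = p l y"
proof -
  have "p l ` \<Omega> \<subseteq> \<real>"
    using assms(1,2) by (simp add: real_orthonormal_basis_def)
  then show ?thesis
    using \<open>y \<in> \<Omega>\<close> by (auto simp: Reals_cnj_iff)
qed

lemma real_orthonormal_basis_expansion:
  assumes "real_orthonormal_basis S \<Omega> M n d p" "g \<in> poly_space S \<Omega> n"
  shows "\<exists>c. \<forall>y\<in>\<Omega>. g y = (\<Sum>l=1..d. c l * p l y)"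
proof -
  have "\<forall>g\<in>poly_space S \<Omega> n. \<exists>c. c ` {1..d} \<subseteq> S \<and> (\<forall>y\<in>\<Omega>. g y = (\<Sum>l=1..d. c l * p l y))"
    using assms(1) unfolding real_orthonormal_basis_def by (elim conjE)
  from bspec[OF this assms(2)] show ?thesis
    by (elim exE conjE) (rule exI)
qed

subsection \<open>Hyperinterpolation\<close>

lemma hyperinterp_diff:
  "hyperinterp m x w d p (\<lambda>y. g y - h y) y = hyperinterp m x w d p g y - hyperinterp m x w d p h y"
  by (simp add: hyperinterp_def discrete_inner_def algebra_simps sum_subtractf)

lemma hyperinterp_scale:
  "hyperinterp m x w d p (\<lambda>y. c * g y) y = c * hyperinterp m x w d p g y"
  by (simp add: hyperinterp_def discrete_inner_def mult_ac sum_distrib_left)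

lemma continuous_on_hyperinterp:
  "(\<And>l. l \<in> {1..d} \<Longrightarrow> continuous_on \<Omega> (p l)) \<Longrightarrow> continuous_on \<Omega> (hyperinterp m x w d p g)"
  unfolding hyperinterp_def by (intro continuous_intros)

text \<open>A crude bound from the triangle inequality. It shows that the supremum defining the
  operator norm is over a bounded set, and with \<open>c = 0\<close> it settles functions of norm
  0.\<close>

lemma sup_norm_hyperinterp_le:
  assumes \<Omega>: "compact \<Omega>" "\<Omega> \<noteq> {}" and p: "\<And>l. l \<in> {1..d} \<Longrightarrow> continuous_on \<Omega> (p l)"
    and x: "quadrature_rule \<Omega> m x w" and g: "continuous_on \<Omega> g" "sup_norm \<Omega> g \<le> c"
  shows "sup_norm \<Omega> (hyperinterp m x w d p g)
    \<le> (\<Sum>l=1..d. (\<Sum>j=1..m. w j * c * cmod (p l (x j))) * sup_norm \<Omega> (p l))"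
proof (rule sup_norm_le[OF \<Omega>(2)])
  fix y
  assume y: "y \<in> \<Omega>"
  have g': "cmod (g (x j)) \<le> c" if "j \<in> {1..m}" for j
    using x that cmod_le_sup_norm[OF \<Omega>(1) g(1)] g(2) by (force simp: quadrature_rule_def)
  have "cmod (discrete_inner m x w g (p l)) \<le> (\<Sum>j=1..m. w j * c * cmod (p l (x j)))" for l
    unfolding discrete_inner_def
  proof (rule sum_norm_le)
    fix j
    assume j: "j \<in> {1..m}"
    then have "0 < w j"
      using x by (simp add: quadrature_rule_def)
    then show "cmod (complex_of_real (w j) * g (x j) * cnj (p l (x j))) \<le> w j * c * cmod (p l (x j))"
      using g'[OF j] by (auto simp: norm_mult intro!: mult_right_mono)
  qed
  then show "cmod (hyperinterp m x w d p g y)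
      \<le> (\<Sum>l=1..d. (\<Sum>j=1..m. w j * c * cmod (p l (x j))) * sup_norm \<Omega> (p l))"
    unfolding hyperinterp_def
    by (intro sum_norm_le) (auto simp: norm_mult intro!: mult_mono' cmod_le_sup_norm[OF \<Omega>(1) p y])
qed

text \<open>Homogeneity reduces the claim to the unit ball, over which \<open>sup_op_norm\<close>
  takes its supremum.\<close>

lemma sup_norm_hyperinterp_le_op_norm:
  assumes \<Omega>: "compact \<Omega>" "\<Omega> \<noteq> {}" and p: "\<And>l. l \<in> {1..d} \<Longrightarrow> continuous_on \<Omega> (p l)"
    and x: "quadrature_rule \<Omega> m x w" and g: "g \<in> cont_space S \<Omega>"
    and S: "\<And>c u. u \<in> S \<Longrightarrow> complex_of_real c * u \<in> S"
  shows "sup_norm \<Omega> (hyperinterp m x w d p g)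
    \<le> sup_op_norm S \<Omega> (hyperinterp m x w d p) * sup_norm \<Omega> g"
proof -
  let ?L = "hyperinterp m x w d p"
  have cont: "continuous_on \<Omega> g"
    using g by (simp add: cont_space_def)
  note L_cont = continuous_on_hyperinterp[OF p]
  have bdd: "bdd_above ((\<lambda>g. sup_norm \<Omega> (?L g)) ` {g \<in> cont_space S \<Omega>. sup_norm \<Omega> g \<le> 1})"
    using sup_norm_hyperinterp_le[OF \<Omega> p x]
    by (intro bdd_aboveI2) (auto simp: cont_space_def)
  show ?thesis
  proof (cases "sup_norm \<Omega> g = 0")
    case True
    then show ?thesis
      using sup_norm_hyperinterp_le[OF \<Omega> p x cont, where c = 0] by simp
  next
    case False
    define r where "r = sup_norm \<Omega> g"
    have r: "0 < r"
      using False sup_norm_nonneg[OF \<Omega> cont] by (simp add: r_def)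
    \<comment> \<open>The normalisation of \<open>g\<close>. Its factor is real, so \<open>h\<close>
      still takes values in \<open>S\<close> when the scalars are real.\<close>
    define h where "h = (\<lambda>y. complex_of_real (1 / r) * g y)"
    have h_cont: "continuous_on \<Omega> h"
      unfolding h_def by (intro continuous_intros cont)
    have "h ` \<Omega> \<subseteq> S"
      using g S unfolding h_def cont_space_def by blast
    moreover have "sup_norm \<Omega> h \<le> 1"
      using sup_norm_scaleR_le[OF \<Omega> cont, where c = "1 / r"] r by (simp add: h_def r_def)
    ultimately have "sup_norm \<Omega> (?L h) \<le> sup_op_norm S \<Omega> ?L"
      unfolding sup_op_norm_def by (intro cSUP_upper bdd) (simp add: cont_space_def h_cont)
    moreover have "?L g = (\<lambda>y. complex_of_real r * ?L h y)"
      using r unfolding h_def hyperinterp_scale by (simp add: field_simps)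
    then have "sup_norm \<Omega> (?L g) \<le> r * sup_norm \<Omega> (?L h)"
      using sup_norm_scaleR_le[OF \<Omega> L_cont, where c = r] r by simp
    moreover have "r * sup_norm \<Omega> (?L h) \<le> r * sup_op_norm S \<Omega> ?L"
      using calculation(1) r by (intro mult_left_mono) auto
    ultimately show ?thesis
      unfolding r_def[symmetric] by (simp add: mult.commute)
  qed
qed

text \<open>The discrete coefficients of \<open>q\<close> equal its true coefficients in the basis.
  Membership in degree \<open>n\<close> provides the expansion of \<open>q\<close>; membership in
  degree \<open>n'\<close> keeps its products with basis elements within the exactness
  degree.\<close>

lemma hyperinterp_reproduces:
  assumes basis: "real_orthonormal_basis S \<Omega> M n d p"
    and x: "quadrature_rule \<Omega> m x w" and exact: "exactness_degree S \<Omega> M m x w (n + n')"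
    and M: "space M = \<Omega>" and p: "\<And>l. l \<in> {1..d} \<Longrightarrow> p l \<in> Lp_space 2 M"
    and q: "q \<in> poly_space S \<Omega> n'" "q \<in> poly_space S \<Omega> n" and y: "y \<in> \<Omega>"
    and S: "0 \<in> S" "\<And>u v. u \<in> S \<Longrightarrow> v \<in> S \<Longrightarrow> u + v \<in> S"
      "\<And>u v. u \<in> S \<Longrightarrow> v \<in> S \<Longrightarrow> u * v \<in> S"
  shows "hyperinterp m x w d p q y = q y"
proof -
  note real = real_orthonormal_basis_cnj[OF basis]
  obtain c where c: "\<And>z. z \<in> \<Omega> \<Longrightarrow> q z = (\<Sum>l=1..d. c l * p l z)"
    using real_orthonormal_basis_expansion[OF basis q(2)] by metis
  have "discrete_inner m x w q (p l) = c l" if l: "l \<in> {1..d}" for l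
  proof -
    \<comment> \<open>The degree \<open>n'\<close> of \<open>q\<close> and the degree
      \<open>n\<close> of \<open>p l\<close> add up to exactly the degree of exactness.\<close>
    have "(\<lambda>z. q z * p l z) \<in> poly_space S \<Omega> (n + n')"
      using poly_space_mult[OF q(1) _ S, of "p l" n] basis l
      by (simp add: real_orthonormal_basis_def add.commute)
    with exact have "(\<Sum>j=1..m. complex_of_real (w j) * (q (x j) * p l (x j))) = (\<integral>z. q z * p l z \<partial>M)"
      unfolding exactness_degree_def by (rule bspec)
    moreover have "discrete_inner m x w q (p l) = (\<Sum>j=1..m. complex_of_real (w j) * (q (x j) * p l (x j)))"
      unfolding discrete_inner_def
      using x l by (intro sum.cong) (auto simp: real quadrature_rule_def)
    moreover have "(\<integral>z. q z * p l z \<partial>M) = (\<integral>z. (\<Sum>k=1..d. c k * (p k z * cnj (p l z))) \<partial>M)"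
      using l by (intro Bochner_Integration.integral_cong)
        (simp_all add: M c real sum_distrib_right mult.assoc)
    moreover have "\<dots> = (\<Sum>k=1..d. \<integral>z. c k * (p k z * cnj (p l z)) \<partial>M)"
      using l by (intro Bochner_Integration.integral_sum integrable_mult_right L2_integrable_mult p)
    moreover have "\<dots> = (\<Sum>k=1..d. c k * L2_inner M (p k) (p l))"
      by (simp add: L2_inner_def)
    moreover have "\<dots> = (\<Sum>k=1..d. if k = l then c k else 0)"
      using basis l by (intro sum.cong) (auto simp: real_orthonormal_basis_def)
    moreover have "\<dots> = c l"
      using l by simp
    ultimately show ?thesis
      by presburger
  qed
  then show ?thesis
    unfolding hyperinterp_def c[OF y] by (intro sum.cong refl) (simp only:)
qed

section \<open>Continuous functions on the region\<close>

lemma borel_measurable_region: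
  fixes g :: "'a::euclidean_space \<Rightarrow> complex"
  assumes "region_measure \<Omega> M" "continuous_on \<Omega> g"
  shows "g \<in> borel_measurable M"
proof -
  have M: "sets (restrict_space borel \<Omega>) \<subseteq> sets M" "space M = \<Omega>"
    using assms(1) by (simp_all add: region_measure_def)
  have g: "g \<in> borel_measurable (restrict_space borel \<Omega>)"
    by (rule borel_measurable_continuous_on_restrict[OF assms(2)])
  show ?thesis
  proof (rule measurableI)
    fix A :: "complex set"
    assume "A \<in> sets borel"
    \<comment> \<open>The preimage is Borel relative to \<open>\<Omega>\<close>, and the possibly
      larger collection \<open>sets M\<close> contains all such sets.\<close>
    then have "g -` A \<inter> \<Omega> \<in> sets (restrict_space borel \<Omega>)"
      using measurable_sets[OF g] by (simp add: space_restrict_space)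
    with M show "g -` A \<inter> space M \<in> sets M"
      by blast
  qed simp
qed

lemma continuous_on_in_L2:
  fixes g :: "'a::euclidean_space \<Rightarrow> complex"
  assumes "region_measure \<Omega> M" "compact \<Omega>" "continuous_on \<Omega> g"
  shows "g \<in> Lp_space 2 M"
proof -
  interpret finite_measure M
    using assms(1) by (simp add: region_measure_def)
  \<comment> \<open>Constants are square-integrable because the total mass is finite; a continuous
    function is the constant 1 times a bounded multiplier.\<close>
  have "(\<lambda>_. 1) \<in> Lp_space 2 M"
    by (simp add: Lp_space_2_iff)
  then show ?thesis
    using L2_mult_bounded[OF _ borel_measurable_region[OF assms(1,3)], of "\<lambda>_. 1" "sup_norm \<Omega> g"]
      cmod_le_sup_norm[OF assms(2,3)] assms(1) by (simp add: region_measure_def)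
qed

text \<open>In the first case the region is a closure, hence closed and bounded; in the manifold
  case compactness is part of the definition.\<close>

lemma bounded_region_compact: "bounded_region \<Omega> \<Longrightarrow> compact \<Omega>"
  by (auto simp: bounded_region_def compact_eq_bounded_closed)

section \<open>The stability bound and the error estimate\<close>

theorem theorem5p1:
  fixes \<Omega> :: "(real ^ 's) set"
    and M :: "(real ^ 's) measure"
    and K f F :: "real ^ 's \<Rightarrow> complex"
    and S :: "complex set"
    and n n' m d :: nat
    and p :: "nat \<Rightarrow> real ^ 's \<Rightarrow> complex"
    and x :: "nat \<Rightarrow> real ^ 's"
    and w :: "nat \<Rightarrow> real"
    and \<eta> :: real
    and L :: "(real ^ 's \<Rightarrow> complex) \<Rightarrow> real ^ 's \<Rightarrow> complex"
    and SF :: "real ^ 's \<Rightarrow> complex"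
  assumes "bounded_region \<Omega>"
    and "region_measure \<Omega> M"
    and "K \<in> Lp_space 1 M \<inter> Lp_space 2 M"
    and "continuous_on \<Omega> f"
    and "F = (\<lambda>y. K y * f y)"
    and "S = scalars_for \<Omega> K f"
    and "0 < n'" and "n' \<le> n"
    and "real_orthonormal_basis S \<Omega> M n d p"
    and "quadrature_rule \<Omega> m x w"
    and "exactness_degree S \<Omega> M m x w (n + n')"
    and "MZ_property S \<Omega> M m x w n n' \<eta>"
    and "L = hyperinterp m x w d p"
    and "SF = efficient_hyperinterp M m x w d p K f"
  shows "Lp_norm 2 M SF \<le> Lp_norm 2 M K * sup_op_norm S \<Omega> L * sup_norm \<Omega> f \<and>
    (\<forall>q. q \<in> poly_space S \<Omega> n' \<and>
       sup_norm \<Omega> (\<lambda>y. f y - q y) = best_unif_err S \<Omega> n' f \<longrightarrow>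
       Lp_norm 2 M (\<lambda>y. SF y - F y)
         \<le> (1 + sup_op_norm S \<Omega> L) * Lp_norm 2 M K * best_unif_err S \<Omega> n' f
           + 2 * best_L2_err S \<Omega> M n (\<lambda>y. K y * q y))"
proof -
  have \<Omega>: "compact \<Omega>" "\<Omega> \<noteq> {}"
    using bounded_region_compact[OF assms(1)] assms(1) by (simp_all add: bounded_region_def)
  have M: "space M = \<Omega>"
    using assms(2) by (simp add: region_measure_def)
  have K: "K \<in> Lp_space 2 M"
    using assms(3) by simp
  note S = scalars_for_closed[OF assms(6)]
  note meas = borel_measurable_region[OF assms(2)]
  have p_cont: "continuous_on \<Omega> (p l)" if "l \<in> {1..d}" for l
    using assms(9) that by (auto simp: real_orthonormal_basis_def intro: continuous_on_poly_space)
  have p_L2: "p l \<in> Lp_space 2 M" if "l \<in> {1..d}" for l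
    by (rule continuous_on_in_L2[OF assms(2) \<Omega>(1) p_cont[OF that]])
  have on: "L2_inner M (p k) (p l) = (if k = l then 1 else 0)" if "k \<in> {1..d}" "l \<in> {1..d}" for k l
    using assms(9) that by (simp add: real_orthonormal_basis_def)
  note proj_norm = L2_projection_norm_le[OF _ p_L2 on]
    and proj_best = L2_projection_best[OF _ p_L2 on]
  define P where "P g = (\<lambda>y. \<Sum>l=1..d. L2_inner M g (p l) * p l y)" for g
  have P_norm: "Lp_norm 2 M (P g) \<le> Lp_norm 2 M g" if "g \<in> Lp_space 2 M" for g
    unfolding P_def using that by (intro proj_norm) simp_all
  have P_L2: "P g \<in> Lp_space 2 M" for g
    unfolding P_def by (intro L2_sum L2_scale p_L2)
  have L_cont: "continuous_on \<Omega> (L g)" for g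
    unfolding assms(13) by (rule continuous_on_hyperinterp[OF p_cont])
  have K_mult: "(\<lambda>y. K y * u y) \<in> Lp_space 2 M"
    and K_mult_norm: "Lp_norm 2 M (\<lambda>y. K y * u y) \<le> Lp_norm 2 M K * sup_norm \<Omega> u"
    if u: "continuous_on \<Omega> u" for u
    using L2_mult_bounded[OF K meas[OF u]] Lp_norm_2_mult_bounded[OF K meas[OF u]]
      cmod_le_sup_norm[OF \<Omega>(1) u] sup_norm_nonneg[OF \<Omega> u] M by blast+
  have L_norm: "sup_norm \<Omega> (L g) \<le> sup_op_norm S \<Omega> L * sup_norm \<Omega> g" if "g \<in> cont_space S \<Omega>" for g
    unfolding assms(13)
    by (rule sup_norm_hyperinterp_le_op_norm[OF \<Omega> p_cont assms(10) that]) (auto intro: S)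
  \<comment> \<open>Stated for general \<open>g\<close> because it serves twice:
    \<open>g = f\<close> gives the stability bound, and \<open>g = f - q\<close> the first piece of
    the error.\<close>
  have PKL: "Lp_norm 2 M (P (\<lambda>y. K y * L g y)) \<le> Lp_norm 2 M K * sup_op_norm S \<Omega> L * sup_norm \<Omega> g"
    if "g \<in> cont_space S \<Omega>" for g
  proof -
    have "Lp_norm 2 M (P (\<lambda>y. K y * L g y)) \<le> Lp_norm 2 M K * sup_norm \<Omega> (L g)"
      using P_norm[OF K_mult[OF L_cont]] K_mult_norm[OF L_cont] by (rule order_trans)
    also have "\<dots> \<le> Lp_norm 2 M K * (sup_op_norm S \<Omega> L * sup_norm \<Omega> g)"
      by (intro mult_left_mono L_norm that Lp_norm_nonneg)
    finally show ?thesis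
      by (simp add: mult.assoc)
  qed
  have SF: "SF = P (\<lambda>y. K y * L f y)"
  proof -
    have "(\<integral>z. K z * L f z * p l z \<partial>M) = L2_inner M (\<lambda>y. K y * L f y) (p l)" if "l \<in> {1..d}" for l
    proof -
      have "cnj (p l z) = p l z" if "z \<in> \<Omega>" for z
        by (rule real_orthonormal_basis_cnj[OF assms(9) \<open>l \<in> {1..d}\<close> that])
      then show ?thesis
        unfolding L2_inner_def by (intro Bochner_Integration.integral_cong) (simp_all add: M)
    qed
    then show ?thesis
      unfolding assms(14) P_def efficient_hyperinterp_def assms(13)[symmetric]
      by (intro ext sum.cong) simp_all
  qed
  have f: "f \<in> cont_space S \<Omega>"
    using assms(4) S(6) by (simp add: cont_space_def)
  have "Lp_norm 2 M (\<lambda>y. SF y - F y)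
      \<le> (1 + sup_op_norm S \<Omega> L) * Lp_norm 2 M K * best_unif_err S \<Omega> n' f
        + 2 * best_L2_err S \<Omega> M n (\<lambda>y. K y * q y)"
    if q: "q \<in> poly_space S \<Omega> n'"
      and best: "sup_norm \<Omega> (\<lambda>y. f y - q y) = best_unif_err S \<Omega> n' f" for q
  proof -
    let ?E = "best_unif_err S \<Omega> n' f" and ?E2 = "best_L2_err S \<Omega> M n (\<lambda>y. K y * q y)"
    have q_cont: "continuous_on \<Omega> q"
      by (rule continuous_on_poly_space[OF q])
    have q': "q \<in> poly_space S \<Omega> n"
      using poly_space_mono[OF S(1) assms(8)] q by blast
    have fq_cont: "continuous_on \<Omega> (\<lambda>y. f y - q y)"
      by (intro continuous_intros assms(4) q_cont)
    \<comment> \<open>The operator norm only controls functions with values in \<open>S\<close>, so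
      \<open>q\<close> must be real-valued on \<open>\<Omega>\<close> whenever the scalars are
      real.\<close>
    have fq: "(\<lambda>y. f y - q y) \<in> cont_space S \<Omega>"
      using fq_cont S(3,6) poly_space_scalars[OF assms(6) q]
      unfolding cont_space_def by (simp add: image_subset_iff)
    have Lq: "L q y = q y" if "y \<in> \<Omega>" for y
      unfolding assms(13)
      by (rule hyperinterp_reproduces[OF assms(9,10,11) M p_L2 q q' that S(1,2,4)])
    define u where "u = P (\<lambda>y. K y * L (\<lambda>y. f y - q y) y)"
    define v where "v = (\<lambda>y. K y * q y - P (\<lambda>y. K y * q y) y)"
    define t where "t = (\<lambda>y. K y * (f y - q y))"
    have L2: "u \<in> Lp_space 2 M" "v \<in> Lp_space 2 M" "t \<in> Lp_space 2 M"
      unfolding u_def v_def t_def by (intro P_L2 L2_diff K_mult q_cont fq_cont)+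
    \<comment> \<open>This holds at every \<open>y\<close>, even outside \<open>\<Omega>\<close>:
      reproduction of \<open>q\<close> is used only under the integrals, and the projections are
      then compared through their coefficients. The factors \<open>- 1\<close> are explicit to match
      \<open>L2_scale\<close>.\<close>
    have split: "SF y - F y = u y + (- 1 * v y + - 1 * t y)" for y
    proof -
      have "L2_inner M (\<lambda>y. K y * L f y) (p l)
          = L2_inner M (\<lambda>y. K y * L (\<lambda>y. f y - q y) y) (p l) + L2_inner M (\<lambda>y. K y * q y) (p l)"
        if "l \<in> {1..d}" for l
      proof -
        have "L2_inner M (\<lambda>y. K y * L f y) (p l) = (\<integral>y. K y * L (\<lambda>y. f y - q y) y * cnj (p l y)
            + K y * q y * cnj (p l y) \<partial>M)"
          unfolding L2_inner_def
          by (intro Bochner_Integration.integral_cong)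
            (auto simp: M Lq[symmetric] assms(13) hyperinterp_diff algebra_simps)
        also have "\<dots> = (\<integral>y. K y * L (\<lambda>y. f y - q y) y * cnj (p l y) \<partial>M)
            + (\<integral>y. K y * q y * cnj (p l y) \<partial>M)"
          by (intro Bochner_Integration.integral_add L2_integrable_mult K_mult L_cont q_cont p_L2 that)
        finally show ?thesis
          by (simp add: L2_inner_def)
      qed
      then have "SF y = u y + P (\<lambda>y. K y * q y) y"
        unfolding SF u_def P_def sum.distrib[symmetric] by (intro sum.cong) (simp_all add: distrib_right)
      then show ?thesis
        by (simp add: v_def t_def assms(5) algebra_simps)
    qed
    have "Lp_norm 2 M (\<lambda>y. SF y - F y) \<le> Lp_norm 2 M u + (Lp_norm 2 M v + Lp_norm 2 M t)"
    proof -
      have "Lp_norm 2 M (\<lambda>y. SF y - F y) \<le> Lp_norm 2 M u + Lp_norm 2 M (\<lambda>y. - 1 * v y + - 1 * t y)"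
        unfolding split by (intro Lp_norm_2_triangle L2_add L2_scale L2)
      also have "Lp_norm 2 M (\<lambda>y. - 1 * v y + - 1 * t y)
          \<le> Lp_norm 2 M (\<lambda>y. - 1 * v y) + Lp_norm 2 M (\<lambda>y. - 1 * t y)"
        by (intro Lp_norm_2_triangle L2_scale L2)
      also have "Lp_norm 2 M (\<lambda>y. - 1 * v y) = Lp_norm 2 M v"
        by (rule Lp_norm_cong) simp
      also have "Lp_norm 2 M (\<lambda>y. - 1 * t y) = Lp_norm 2 M t"
        by (rule Lp_norm_cong) simp
      finally show ?thesis
        by simp
    qed
    moreover have "Lp_norm 2 M u \<le> Lp_norm 2 M K * sup_op_norm S \<Omega> L * ?E"
      unfolding u_def best[symmetric] by (rule PKL[OF fq])
    moreover have "Lp_norm 2 M t \<le> Lp_norm 2 M K * ?E"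
      unfolding t_def best[symmetric] by (rule K_mult_norm[OF fq_cont])
    \<comment> \<open>\<open>v\<close> is the projection error of \<open>K q\<close>. On
      \<open>\<Omega>\<close> every competitor \<open>r\<close> is a combination of the basis, so
      the best-approximation property applies to each one before the infimum is taken.\<close>
    moreover have "Lp_norm 2 M v \<le> ?E2"
      unfolding best_L2_err_def
    proof (rule cINF_greatest)
      show "poly_space S \<Omega> n \<noteq> {}"
        using q' by blast
      fix r
      assume "r \<in> poly_space S \<Omega> n"
      then obtain c where c: "\<And>y. y \<in> \<Omega> \<Longrightarrow> r y = (\<Sum>l=1..d. c l * p l y)"
        using real_orthonormal_basis_expansion[OF assms(9)] by metis
      have "Lp_norm 2 M v \<le> Lp_norm 2 M (\<lambda>y. K y * q y - (\<Sum>l=1..d. c l * p l y))"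
        unfolding v_def P_def by (rule proj_best) (simp_all add: K_mult[OF q_cont])
      also have "\<dots> = Lp_norm 2 M (\<lambda>y. K y * q y - r y)"
        by (rule Lp_norm_cong) (simp add: M c)
      finally show "Lp_norm 2 M v \<le> Lp_norm 2 M (\<lambda>y. K y * q y - r y)" .
    qed
    \<comment> \<open>Together with the previous bound this makes \<open>?E2\<close> nonnegative, so
      the single \<open>?E2\<close> obtained is at most the claimed \<open>2 * ?E2\<close>.\<close>
    moreover have "0 \<le> Lp_norm 2 M v"
      by (rule Lp_norm_nonneg)
    ultimately show ?thesis
      by (simp add: algebra_simps)
  qed
  moreover have "Lp_norm 2 M SF \<le> Lp_norm 2 M K * sup_op_norm S \<Omega> L * sup_norm \<Omega> f"
    unfolding SF by (rule PKL[OF f])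
  ultimately show ?thesis
    by blast
qed

end
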